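(* For all integers $n\ge 0$, $$\beta_n+q\,\beta_{n+1}=\sum_{k=0}^{n}(-1)^k\frac{[k]!}{[k+2]}\,S_q(n,k).$$
   Context: Let $q$ be a positive real number, $q\neq 1$, and put $[X]:=\frac{q^X-1}{q-1}$. For an integer $k\ge 0$, $[X]_k:=[X][X-1]\cdots[X-k+1]$ (with $[X]_0=1$), and $[k]!:=[k]_k=[k][k-1]\cdots[1]$. The $q$-Stirling numbers of the second kind $S_q(n,k)$ ($n\ge k\ge 0$) are defined by the identities $$[X]^n=\sum_{k=0}^{n}q^{\frac12 k(k-1)}S_q(n,k)\,[X]_k\qquad(n\ge 0).$$ The Carlitz $q$-Bernoulli numbers $\beta_n$ ($n\ge 0$) are $$\beta_n:=(q-1)^{-n}\sum_{k=0}^{n}(-1)^{n-k}\binom{n}{k}\frac{k+1}{[k+1]}.$$ *)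

theory Defs
  imports Complex_Main
begin

definition qnum :: "real \<Rightarrow> real \<Rightarrow> real" where
  "qnum q X = (q powr X - 1) / (q - 1)"

definition qfalling :: "real \<Rightarrow> real \<Rightarrow> nat \<Rightarrow> real" where
  "qfalling q X k = (\<Prod>i<k. qnum q (X - real i))"

definition qfact :: "real \<Rightarrow> nat \<Rightarrow> real" where
  "qfact q k = qfalling q (real k) k"

(* The defining identities, read as identities of functions of a real variable X.
   They involve S n k only for k <= n; the values with k > n are set to 0 so that,
   for q > 0 and q \<noteq> 1, exactly one function S qualifies
   (uniqueness: put X = 0, ..., n and use [m]_m \<noteq> 0 and [m]_k = 0 for k > m;
   existence: expand [X][X]_k using [X] = [k] + q^k [X-k]). *)
definition is_qStirling :: "real \<Rightarrow> (nat \<Rightarrow> nat \<Rightarrow> real) \<Rightarrow> bool" where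
  "is_qStirling q S \<longleftrightarrow>
     (\<forall>n. \<forall>X::real. qnum q X ^ n =
        (\<Sum>k=0..n. q ^ (k * (k - 1) div 2) * S n k * qfalling q X k)) \<and>
     (\<forall>n k. n < k \<longrightarrow> S n k = 0)"

definition qStirling :: "real \<Rightarrow> nat \<Rightarrow> nat \<Rightarrow> real" where
  "qStirling q = (THE S. is_qStirling q S)"

definition carlitz_beta :: "real \<Rightarrow> nat \<Rightarrow> real" where
  "carlitz_beta q n = (q - 1) powi (- int n) *
     (\<Sum>k=0..n. (- 1) ^ (n - k) * real (n choose k) * (real (k + 1) / qnum q (real (k + 1))))"

end

theory Submission
  imports Defs "HOL-Computational_Algebra.Polynomial"
begin

text \<open>
  Put \<open>Q = q\<^sup>X\<close> and let \<open>L\<close> be the linear functional on polynomials in \<open>Q\<close> that sends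
  \<open>Q\<^sup>k\<close> to \<open>(k + 1) / [k + 1]\<close>, so that \<open>\<beta>\<^sub>n = L ([X]\<^sup>n)\<close>. As \<open>1 + q[X] = [X + 1]\<close>, the left-hand
  side is \<open>L ([X + 1][X]\<^sup>n)\<close>, and expanding \<open>[X]\<^sup>n\<close> in \<open>q\<close>-falling factorials reduces the claim to
  the values \<open>L ([X + 1][X]\<^sub>k)\<close>. Now \<open>L f = (q - 1) G'(1)\<close> whenever \<open>G (qQ) - G Q = Q f Q\<close>, and for
  \<open>f = [X + 1][X]\<^sub>k\<close> one may take \<open>G = q\<^sup>k [X + 1][X]\<^bsub>k+1\<^esub> / [k + 2]\<close>, which has the factor \<open>[X]\<close>
  vanishing at \<open>Q = 1\<close>; its derivative there is therefore a product of values \<open>[-i] = - q\<^bsup>-i\<^esup> [i]\<close>.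
\<close>

section \<open>Integer q-numbers, q-factorials and the weights\<close>

lemma qnum_of_nat: "q > 0 \<Longrightarrow> qnum q (real k) = (q ^ k - 1) / (q - 1)"
  by (simp add: qnum_def powr_realpow)

lemma power_eq_1_iff_pos:
  fixes q :: real
  assumes "q > 0" "q \<noteq> 1"
  shows "q ^ k = 1 \<longleftrightarrow> k = 0"
  using assms power_eq_1_iff[of q k] by auto

lemma qnum_of_nat_eq_0_iff:
  assumes "q > 0" "q \<noteq> 1"
  shows "qnum q (real k) = 0 \<longleftrightarrow> k = 0"
  using assms by (simp add: qnum_of_nat power_eq_1_iff_pos)

lemma qfact_0 [simp]: "qfact q 0 = 1"
  by (simp add: qfact_def qfalling_def)

lemma qfact_Suc: "qfact q (Suc k) = qnum q (real (Suc k)) * qfact q k"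
  by (simp add: qfact_def qfalling_def prod.lessThan_Suc_shift del: prod.lessThan_Suc)

lemma qfact_neq_0:
  assumes "q > 0" "q \<noteq> 1"
  shows "qfact q k \<noteq> 0"
  using assms
  by (induction k) (simp_all add: qfact_Suc qnum_of_nat_eq_0_iff del: of_nat_Suc)

lemma qfalling_eq_0:
  assumes "q \<noteq> 0" "m < k"
  shows "qfalling q (real m) k = 0"
  unfolding qfalling_def using assms by (auto simp: qnum_def intro!: bexI[of _ m])

definition qweight :: "real \<Rightarrow> nat \<Rightarrow> real" where
  "qweight q k = q ^ (k * (k - 1) div 2)"

lemma qweight_0 [simp]: "qweight q 0 = 1"
  by (simp add: qweight_def)

lemma qweight_Suc: "qweight q (Suc k) = q ^ k * qweight q k"
proof -
  have "Suc k * k = 2 * k + k * (k - 1)"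
    by (cases k) auto
  hence "Suc k * (Suc k - 1) div 2 = k + k * (k - 1) div 2"
    by simp
  thus ?thesis
    by (simp add: qweight_def power_add)
qed

lemma qweight_pos: "q > 0 \<Longrightarrow> qweight q k > 0"
  by (simp add: qweight_def)

subsection \<open>Falling factorials as polynomials in \<open>q\<^sup>X\<close>\<close>

text \<open>\<open>qlin q i\<close> is \<open>[X - i]\<close> and \<open>qup q\<close> is \<open>[X + 1]\<close>, written in the variable \<open>q\<^sup>X\<close>.\<close>

definition qlin :: "real \<Rightarrow> nat \<Rightarrow> real poly" where
  "qlin q i = [:- 1 / (q - 1), 1 / ((q - 1) * q ^ i):]"

definition qup :: "real \<Rightarrow> real poly" where
  "qup q = [:- 1 / (q - 1), q / (q - 1):]"

definition qfalling_poly :: "real \<Rightarrow> nat \<Rightarrow> real poly" where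
  "qfalling_poly q k = (\<Prod>i<k. qlin q i)"

lemma qfalling_poly_Suc: "qfalling_poly q (Suc k) = qlin q k * qfalling_poly q k"
  by (simp add: qfalling_poly_def mult.commute)

lemma poly_qlin: "q > 0 \<Longrightarrow> poly (qlin q i) (q powr X) = qnum q (X - real i)"
  by (simp add: qlin_def qnum_def powr_diff powr_realpow diff_divide_distrib mult.commute)

lemma poly_qfalling_poly: "q > 0 \<Longrightarrow> poly (qfalling_poly q k) (q powr X) = qfalling q X k"
  by (simp add: qfalling_poly_def qfalling_def poly_prod poly_qlin)

text \<open>This is \<open>[X] = [k] + q^k [X - k]\<close>, the source of the recurrence for the
  Stirling numbers.\<close>

lemma qlin_0_eq:
  assumes "q > 0" "q \<noteq> 1"
  shows "qlin q 0 = [:qnum q (real k):] + smult (q ^ k) (qlin q k)"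
proof -
  have "- 1 / d = (x - 1) / d + - x / d" for x d :: real
    by (simp add: diff_divide_distrib)
  thus ?thesis
    using assms by (simp add: qlin_def qnum_of_nat)
qed

lemma qlin_0_mult_qfalling_poly:
  assumes "q > 0" "q \<noteq> 1"
  shows "qlin q 0 * qfalling_poly q k =
    smult (qnum q (real k)) (qfalling_poly q k) + smult (q ^ k) (qfalling_poly q (Suc k))"
  by (subst qlin_0_eq[OF assms, of k]) (simp add: qfalling_poly_Suc algebra_simps)

lemma qup_eq:
  assumes "q \<noteq> 1"
  shows "qup q = 1 + smult q (qlin q 0)"
  using assms by (simp add: qup_def qlin_def one_pCons field_simps)

subsection \<open>Existence and uniqueness of the \<open>q\<close>-Stirling numbers\<close>

text \<open>Expanding \<open>[X] [X]_k\<close> forces this recurrence; its factor \<open>q^k\<close>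
  is absorbed by \<open>qweight q (Suc k) = q^k * qweight q k\<close>.\<close>

fun qstir :: "real \<Rightarrow> nat \<Rightarrow> nat \<Rightarrow> real" where
  "qstir q 0 0 = 1"
| "qstir q 0 (Suc k) = 0"
| "qstir q (Suc n) 0 = 0"
| "qstir q (Suc n) (Suc k) = qnum q (real (Suc k)) * qstir q n (Suc k) + qstir q n k"

lemma qstir_eq_0: "n < k \<Longrightarrow> qstir q n k = 0"
  by (induction q n k rule: qstir.induct) auto

lemma qlin_0_power:
  assumes "q > 0" "q \<noteq> 1"
  shows "qlin q 0 ^ n = (\<Sum>k\<le>n. smult (qweight q k * qstir q n k) (qfalling_poly q k))"
proof (induction n)
  case 0
  then show ?case by (simp add: qfalling_poly_def)
next
  case (Suc n)
  let ?F = "qfalling_poly q"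
  let ?a = "\<lambda>k. smult (qnum q (real k) * qweight q k * qstir q n k) (?F k)"
  let ?b = "\<lambda>k. smult (qweight q (Suc k) * qstir q n k) (?F (Suc k))"
  have a0: "?a 0 = 0"
    using assms by (simp add: qnum_def)
  have a_top: "?a (Suc n) = 0"
    by (simp add: qstir_eq_0)
  have "qlin q 0 ^ Suc n = (\<Sum>k\<le>n. smult (qweight q k * qstir q n k) (qlin q 0 * ?F k))"
    by (simp add: Suc.IH sum_distrib_left)
  also have "\<dots> = (\<Sum>k\<le>n. ?a k + ?b k)"
    by (intro sum.cong refl)
      (simp add: qlin_0_mult_qfalling_poly[OF assms] qweight_Suc smult_add_right, simp add: mult_ac)
  \<comment> \<open>Appending the zero term \<open>?a (Suc n)\<close> and then dropping the zero
    term \<open>?a 0\<close> shifts the index, so that \<open>?a (Suc k)\<close> and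
    \<open>?b k\<close> carry the same falling factorial.\<close>
  also have "\<dots> = (\<Sum>k\<le>Suc n. ?a k) + (\<Sum>k\<le>n. ?b k)"
    unfolding sum.atMost_Suc[of ?a] a_top by (simp add: sum.distrib)
  also have "\<dots> = (\<Sum>k\<le>n. ?a (Suc k) + ?b k)"
    unfolding sum.atMost_Suc_shift[of ?a] a0 by (simp add: sum.distrib)
  also have "\<dots> = (\<Sum>k\<le>Suc n. smult (qweight q k * qstir q (Suc n) k) (?F k))"
    unfolding sum.atMost_Suc_shift[of "\<lambda>k. smult (qweight q k * qstir q (Suc n) k) (?F k)"]
    by (simp add: smult_add_left[symmetric] distrib_left mult_ac del: of_nat_Suc)
  finally show ?case .
qed

lemma is_qStirling_qstir:
  assumes "q > 0" "q \<noteq> 1"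
  shows "is_qStirling q (qstir q)"
  unfolding is_qStirling_def
proof (intro conjI allI impI)
  fix n :: nat and X :: real
  have "qnum q X ^ n = poly (qlin q 0 ^ n) (q powr X)"
    using assms by (simp add: poly_qlin)
  also have "\<dots> = (\<Sum>k=0..n. q ^ (k * (k - 1) div 2) * qstir q n k * qfalling q X k)"
    using assms
    by (simp add: qlin_0_power poly_sum poly_qfalling_poly qweight_def atLeast0AtMost)
  finally show "qnum q X ^ n = \<dots>" .
qed (rule qstir_eq_0)

text \<open>Evaluation at \<open>X = 0, ..., n\<close> gives a triangular linear system with nonzero
  diagonal entries \<open>qweight q k * qfact q k\<close>.\<close>

lemma is_qStirling_unique:
  assumes q: "q > 0" "q \<noteq> 1" and S: "is_qStirling q S" and T: "is_qStirling q T"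
  shows "S = T"
proof (intro ext)
  fix n k
  have *: "(\<Sum>k=0..n. qweight q k * S n k * qfalling q X k) =
      (\<Sum>k=0..n. qweight q k * T n k * qfalling q X k)" for X
    using S T unfolding is_qStirling_def qweight_def by metis
  show "S n k = T n k"
  proof (induction k rule: less_induct)
    case (less k)
    show ?case
    proof (cases "k \<le> n")
      case True
      have eq: "(\<Sum>j=0..n. qweight q j * U n j * qfalling q (real k) j) =
          (\<Sum>j<k. qweight q j * U n j * qfalling q (real k) j) + qweight q k * U n k * qfact q k"
        for U :: "nat \<Rightarrow> nat \<Rightarrow> real"
      proof -
        have "(\<Sum>j=0..n. qweight q j * U n j * qfalling q (real k) j) =
            (\<Sum>j\<le>k. qweight q j * U n j * qfalling q (real k) j)"
          using True by (intro sum.mono_neutral_right) (auto intro!: qfalling_eq_0 simp: less_imp_neq[OF q(1), symmetric])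
        thus ?thesis
          by (simp add: lessThan_Suc_atMost[symmetric] qfact_def)
      qed
      have "qweight q k * S n k * qfact q k = qweight q k * T n k * qfact q k"
        using *[of "real k"] less.IH unfolding eq by simp
      thus ?thesis
        using qfact_neq_0[OF q, of k] qweight_pos[OF q(1), of k] by simp
    next
      case False
      thus ?thesis
        using S T by (simp add: is_qStirling_def)
    qed
  qed
qed

lemma qStirling_eq_qstir:
  assumes "q > 0" "q \<noteq> 1"
  shows "qStirling q = qstir q"
  unfolding qStirling_def
  using assms is_qStirling_qstir is_qStirling_unique by (intro the_equality) blast+

subsection \<open>The Bernoulli functional\<close>

definition bern :: "real \<Rightarrow> real poly \<Rightarrow> real" where
  "bern q p = (\<Sum>i\<le>degree p. coeff p i * (real (i + 1) / qnum q (real (i + 1))))"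

lemma bern_eq:
  assumes "degree p \<le> N"
  shows "bern q p = (\<Sum>i\<le>N. coeff p i * (real (i + 1) / qnum q (real (i + 1))))"
  unfolding bern_def using assms
  by (intro sum.mono_neutral_left) (auto simp: coeff_eq_0)

lemma bern_add: "bern q (p + r) = bern q p + bern q r"
proof -
  define N where "N = max (degree p) (degree r)"
  have "degree p \<le> N" "degree r \<le> N" "degree (p + r) \<le> N"
    by (simp_all add: N_def degree_add_le)
  from this[THEN bern_eq] show ?thesis
    by (simp add: sum.distrib[symmetric] algebra_simps add_divide_distrib)
qed

lemma bern_smult: "bern q (smult c p) = c * bern q p"
  using bern_eq[of "smult c p" "degree p"]
  by (simp add: bern_def degree_smult_le sum_distrib_left mult.assoc)

lemma bern_sum: "bern q (\<Sum>i\<in>A. f i) = (\<Sum>i\<in>A. bern q (f i))"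
proof -
  have "bern q 0 = 0" by (simp add: bern_def)
  thus ?thesis
    by (induction A rule: infinite_finite_induct) (simp_all add: bern_add)
qed

lemma bern_qlin_0_power:
  assumes "q \<noteq> 1"
  shows "bern q (qlin q 0 ^ n) = carlitz_beta q n"
proof -
  have "qlin q 0 = smult (inverse (q - 1)) [:- 1, 1:]"
    by (simp add: qlin_def field_simps)
  hence "bern q (qlin q 0 ^ n) = inverse (q - 1) ^ n * bern q ([:- 1, 1:] ^ n)"
    by (simp only: smult_power bern_smult)
  also have "bern q ([:- 1, 1:] ^ n) = (\<Sum>k=0..n. (- 1) ^ (n - k) * real (n choose k) *
      (real (k + 1) / qnum q (real (k + 1))))"
    by (subst bern_eq[of _ n])
      (simp_all add: degree_linear_power coeff_linear_poly_power atLeast0AtMost mult_ac)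
  finally show ?thesis
    by (simp add: carlitz_beta_def power_int_minus power_inverse)
qed

lemma bern_antidifference:
  assumes q: "q > 0" "q \<noteq> 1" and G: "pcompose G [:0, q:] - G = pCons 0 f"
  shows "bern q f = (q - 1) * poly (pderiv G) 1"
proof -
  have coeff_f: "coeff f i = (q ^ (i + 1) - 1) * coeff G (i + 1)" for i
  proof -
    have "coeff f i = coeff (pcompose G [:0, q:] - G) (i + 1)"
      by (simp add: G)
    thus ?thesis
      by (simp add: coeff_pcompose_linear algebra_simps)
  qed
  have "degree f \<le> degree (pderiv G)"
    by (intro degree_le) (auto simp: coeff_f degree_pderiv coeff_eq_0)
  hence "bern q f = (\<Sum>i\<le>degree (pderiv G). (q ^ (i + 1) - 1) * coeff G (i + 1) *
      (real (i + 1) / qnum q (real (i + 1))))"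
    by (simp only: bern_eq coeff_f)
  also have "\<dots> = (\<Sum>i\<le>degree (pderiv G). (q - 1) * coeff (pderiv G) i)"
  proof (intro sum.cong refl)
    fix i
    have "q ^ (i + 1) - 1 \<noteq> 0"
      using power_eq_1_iff_pos[OF q, of "i + 1"] by simp
    thus "(q ^ (i + 1) - 1) * coeff G (i + 1) * (real (i + 1) / qnum q (real (i + 1))) =
        (q - 1) * coeff (pderiv G) i"
      unfolding qnum_of_nat[OF q(1)] by (simp add: coeff_pderiv)
  qed
  finally show ?thesis
    by (simp add: poly_altdef sum_distrib_left)
qed

lemma pcompose_qfalling_poly:
  assumes "q > 0"
  shows "pcompose (qfalling_poly q (Suc k)) [:0, q:] = qup q * qfalling_poly q k"
proof -
  have "pcompose (qlin q (Suc i)) [:0, q:] = qlin q i" for i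
    using assms by (simp add: qlin_def pcompose_pCons)
  moreover have "pcompose (qlin q 0) [:0, q:] = qup q"
    by (simp add: qlin_def qup_def pcompose_pCons)
  ultimately show ?thesis
    by (simp add: qfalling_poly_def pcompose_prod prod.lessThan_Suc_shift pcompose_mult
        del: prod.lessThan_Suc)
qed

lemma qfalling_poly_difference:
  assumes "q > 0" "q \<noteq> 1"
  shows "pcompose (qup q * qfalling_poly q (Suc k)) [:0, q:] - qup q * qfalling_poly q (Suc k) =
    smult (qnum q (real (k + 2)) / q ^ k) (pCons 0 (qup q * qfalling_poly q k))"
proof -
  have "pcompose (qup q) [:0, q:] - qlin q k = [:0, qnum q (real (k + 2)) / q ^ k:]"
  proof -
    have "q * (q / d) - 1 / (d * x) = (x * q\<^sup>2 - 1) / d / x" if "d \<noteq> 0" "x \<noteq> 0" for d x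
      using that by (simp add: field_simps power2_eq_square)
    from this[of "q - 1" "q ^ k"] show ?thesis
      using assms unfolding qnum_of_nat[OF assms(1)]
      by (simp add: qup_def qlin_def pcompose_pCons power_add power2_eq_square)
  qed
  hence "(pcompose (qup q) [:0, q:] - qlin q k) * (qup q * qfalling_poly q k) =
      smult (qnum q (real (k + 2)) / q ^ k) (pCons 0 (qup q * qfalling_poly q k))"
    by simp
  thus ?thesis
    unfolding pcompose_mult pcompose_qfalling_poly[OF assms(1)]
    unfolding qfalling_poly_Suc by (simp add: algebra_simps)
qed

lemma prod_poly_qlin_1:
  assumes "q > 0" "q \<noteq> 1"
  shows "(\<Prod>i<k. poly (qlin q (Suc i)) 1) = (- 1) ^ k * qfact q k / qweight q (Suc k)"
proof (induction k)
  case 0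
  then show ?case by (simp add: qweight_def)
next
  case (Suc k)
  have "poly (qlin q (Suc k)) 1 = - qnum q (real (Suc k)) / q ^ Suc k"
  proof -
    have "- 1 / d + 1 / (d * x) = - ((x - 1) / d) / x" if "d \<noteq> 0" "x \<noteq> 0" for d x :: real
      using that by (simp add: field_simps)
    from this[of "q - 1" "q ^ Suc k"] show ?thesis
      using assms unfolding qnum_of_nat[OF assms(1)] by (simp add: qlin_def)
  qed
  thus ?case
    using assms by (simp add: Suc.IH qfact_Suc qweight_Suc[of q "Suc k"] mult_ac del: of_nat_Suc)
qed

lemma poly_pderiv_qup_qfalling_poly:
  assumes "q > 0" "q \<noteq> 1"
  shows "poly (pderiv (qup q * qfalling_poly q (Suc k))) 1 =
    (- 1) ^ k * qfact q k / ((q - 1) * qweight q (Suc k))"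
proof -
  have "poly (qup q) 1 = 1"
    using assms by (simp add: qup_def add_divide_distrib[symmetric] diff_divide_distrib[symmetric])
  moreover have eq: "qup q * qfalling_poly q (Suc k) = qlin q 0 * (qup q * (\<Prod>i<k. qlin q (Suc i)))"
    by (simp add: qfalling_poly_def prod.lessThan_Suc_shift mult_ac del: prod.lessThan_Suc)
  moreover have "poly (qlin q 0) 1 = 0" "poly (pderiv (qlin q 0)) 1 = 1 / (q - 1)"
    by (simp_all add: qlin_def pderiv_pCons)
  ultimately show ?thesis
    using assms unfolding eq by (simp add: pderiv_mult poly_prod prod_poly_qlin_1)
qed

lemma bern_qup_qfalling_poly:
  assumes "q > 0" "q \<noteq> 1"
  shows "qweight q k * bern q (qup q * qfalling_poly q k) =
    (- 1) ^ k * (qfact q k / qnum q (real (k + 2)))"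
proof -
  let ?G = "qup q * qfalling_poly q (Suc k)"
  define c where "c = q ^ k / qnum q (real (k + 2))"
  have nz: "qnum q (real (k + 2)) \<noteq> 0"
    unfolding qnum_of_nat_eq_0_iff[OF assms] by simp
  have "pcompose (smult c ?G) [:0, q:] - smult c ?G = pCons 0 (qup q * qfalling_poly q k)"
    using assms nz
    unfolding pcompose_smult smult_diff_right[symmetric] qfalling_poly_difference[OF assms]
    by (simp add: c_def)
  from bern_antidifference[OF assms this] show ?thesis
    using assms nz qweight_pos[OF assms(1), of k]
    by (simp add: pderiv_smult poly_pderiv_qup_qfalling_poly c_def qweight_Suc del: of_nat_add)
qed

theorem corollary2p28:
  fixes q :: real and n :: nat
  assumes "q > 0" and "q \<noteq> 1"
  shows "carlitz_beta q n + q * carlitz_beta q (n + 1) =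
    (\<Sum>k=0..n. (- 1) ^ k * (qfact q k / qnum q (real (k + 2))) * qStirling q n k)"
proof -
  have "carlitz_beta q n + q * carlitz_beta q (n + 1) = bern q (qup q * qlin q 0 ^ n)"
    using assms
    by (simp add: qup_eq algebra_simps bern_add bern_smult bern_qlin_0_power flip: power_Suc)
  also have "\<dots> = (\<Sum>k\<le>n. qstir q n k * (qweight q k * bern q (qup q * qfalling_poly q k)))"
    using assms by (simp add: qlin_0_power sum_distrib_left bern_sum bern_smult mult_ac)
  finally show ?thesis
    unfolding bern_qup_qfalling_poly[OF assms] qStirling_eq_qstir[OF assms]
    by (simp only: atLeast0AtMost mult_ac)
qed

end
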